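(* Let $N\in\mathbb N$, $h=1/N$, $\mu>0$, $\beta>0$ and $p=3$. Let $\mathbf u^{k+1}\in\mathbb R^{N-1}$ and $\boldsymbol\alpha^k\in\mathbb R^N$ be given, and set $\rho_n^{k+1}=(S_NR_N\mathbf u^{k+1}+\boldsymbol\alpha^k)_n$ for $n=1,\dots,N$. Then the minimizer $$\mathbf d^{k+1}=\mathop{\mathrm{argmin}}_{\mathbf d\in\mathbb R^N}\left\{\beta\|\mathbf d\|_1+\frac1p\|\mathbf d\|_p^p+\frac{\mu h}{2}\|\mathbf d-S_NR_N\mathbf u^{k+1}-\boldsymbol\alpha^k\|_2^2\right\}$$ is given by $$(\mathbf d^{k+1})_n=\frac{\mu h\,\rho_n^{k+1}}{2|\rho_n^{k+1}|}\left(-1+\sqrt{1+\frac{4}{\mu h}\max\left\{|\rho_n^{k+1}|-\frac{\beta}{\mu h},0\right\}}\right)\qquad\text{for all }n=1,\dots,N,$$ where the right-hand side is understood to be $0$ if $\rho_n^{k+1}=0$.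
   Context: $(\mathbf v)_n$ denotes the $n$-th entry of a vector $\mathbf v$; $\|\mathbf d\|_1=\sum_n|d_n|$, $\|\mathbf d\|_p^p=\sum_n|d_n|^p$, and $\|\cdot\|_2$ is the Euclidean norm. $S_N\in\mathbb R^{N\times N}$ is the periodic backward difference matrix: $(S_N\mathbf y)_n=y_n-y_{n-1}$ for $n=1,\dots,N$, with $y_0:=y_N$. $R_N\in\mathbb R^{N\times(N-1)}$ has the identity matrix of size $N-1$ as its first $N-1$ rows and $(-1,-1,\dots,-1)$ as its last row. *)

theory Defs
  imports Complex_Main "Jordan_Normal_Form.Matrix"
begin

(* Vectors and matrices are indexed from 0, so the entries 1, ..., N of a vector in R^N
   are the entries 0, ..., N - 1 of an element of carrier_vec N. *)

definition norm_1 :: "real vec \<Rightarrow> real" where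
  "norm_1 d = (\<Sum>n<dim_vec d. \<bar>d $ n\<bar>)"

definition norm_p_pow_p :: "real \<Rightarrow> real vec \<Rightarrow> real" where
  "norm_p_pow_p p d = (\<Sum>n<dim_vec d. \<bar>d $ n\<bar> powr p)"

definition norm_2 :: "real vec \<Rightarrow> real" where
  "norm_2 d = sqrt (\<Sum>n<dim_vec d. (d $ n)\<^sup>2)"

(* The cyclic predecessor of index n is (n + N - 1) mod N.  For N = 1 the predecessor
   of 0 is 0 itself, and the two contributions to the single entry cancel. *)
definition diff_mat :: "nat \<Rightarrow> real mat" where
  "diff_mat N = mat N N (\<lambda>(n, m).
     (if m = n then 1 else 0) - (if m = (n + N - 1) mod N then 1 else 0))"

lemma diff_mat_mult_vec:
  assumes "y \<in> carrier_vec N" "n < N"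
  shows "(diff_mat N *\<^sub>v y) $ n = y $ n - y $ (if n = 0 then N - 1 else n - 1)"
proof -
  define k where "k = (if n = 0 then N - 1 else n - 1)"
  have k: "(n + N - 1) mod N = k" "k < N"
    using assms(2) by (auto simp: k_def mod_if)
  have "(diff_mat N *\<^sub>v y) $ n =
    (\<Sum>i = 0..<N. ((if i = n then 1 else 0) - (if i = (n + N - 1) mod N then 1 else 0)) * y $ i)"
    using assms unfolding diff_mat_def by (simp add: scalar_prod_def)
  also have "\<dots> = (\<Sum>i = 0..<N. (if i = n then y $ i else 0) - (if i = k then y $ i else 0))"
    unfolding k(1) by (rule sum.cong) auto
  also have "\<dots> = y $ n - y $ k"
    using assms(2) k(2) by (simp add: sum_subtractf)
  also note k_def
  finally show ?thesis .
qed

definition recon_mat :: "nat \<Rightarrow> real mat" where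
  "recon_mat N = mat N (N - 1) (\<lambda>(n, m).
     if n = N - 1 then - 1 else if n = m then 1 else 0)"

definition d_objective ::
  "nat \<Rightarrow> real \<Rightarrow> real \<Rightarrow> real \<Rightarrow> real \<Rightarrow> real vec \<Rightarrow> real vec \<Rightarrow> real vec \<Rightarrow> real" where
  "d_objective N h \<mu> \<beta> p u \<alpha> d =
     \<beta> * norm_1 d + 1 / p * norm_p_pow_p p d
     + \<mu> * h / 2 * (norm_2 (d - diff_mat N * recon_mat N *\<^sub>v u - \<alpha>))\<^sup>2"

end

theory Submission
  imports Defs
begin

text \<open>
  With \<open>c = \<mu> * h\<close> the objective is the sum over \<open>n\<close> of the values at \<open>d $ n\<close> of the scalar functions
  \<open>x \<mapsto> \<beta> * \<bar>x\<bar> + \<bar>x\<bar>^3 / 3 + c / 2 * (x - \<rho> n)\<^sup>2\<close>, so each entry can be minimized separately.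

  A scalar minimizer \<open>y\<close> is characterized by the vanishing of a subgradient:
  \<open>w + y * \<bar>y\<bar> + c * (y - \<rho> n) = 0\<close>, where \<open>w\<close> is a subgradient of \<open>\<beta> * \<bar>\<cdot>\<bar>\<close> at \<open>y\<close> and
  \<open>y * \<bar>y\<bar>\<close> is the derivative of \<open>\<bar>\<cdot>\<bar>^3 / 3\<close>. Adding the tangent inequalities of the two convex terms
  to the exact expansion of the quadratic one shows that at such a point the function grows at
  least like \<open>c / 2 * (x - y)\<^sup>2\<close> (\<open>stationary_quadratic_growth\<close>).

  To solve the stationarity equation, write \<open>y = sgn (\<rho> n) * t\<close> with \<open>t \<ge> 0\<close>. If \<open>c * \<bar>\<rho> n\<bar> \<le> \<beta>\<close>, then
  \<open>t = 0\<close> with \<open>w = c * \<rho> n\<close>; otherwise \<open>w = sgn (\<rho> n) * \<beta>\<close>, and \<open>t\<close> is the positive root of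
  \<open>t\<^sup>2 + c * t = c * \<bar>\<rho> n\<bar> - \<beta>\<close>. Both cases are the formula of the theorem
  (\<open>shrink_stationary\<close>).

  Summation over the entries gives quadratic growth of the whole objective around the vector
  with these entries. This growth yields existence, uniqueness and the formula at once.
\<close>

definition scalar_objective :: "real \<Rightarrow> real \<Rightarrow> real \<Rightarrow> real \<Rightarrow> real" where
  "scalar_objective \<beta> c r x = \<beta> * \<bar>x\<bar> + \<bar>x\<bar> ^ 3 / 3 + c / 2 * (x - r)\<^sup>2"

text \<open>
  For \<open>\<beta>, c > 0\<close> this is the proximal operator of \<open>(\<beta> * \<bar>\<cdot>\<bar> + \<bar>\<cdot>\<bar>^3 / 3) / c\<close>: soft thresholding at \<open>\<beta> / c\<close>
  followed by the proximal step of the cubic term.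
\<close>

definition shrink :: "real \<Rightarrow> real \<Rightarrow> real \<Rightarrow> real" where
  "shrink \<beta> c r =
    (if r = 0 then 0
     else c * r / (2 * \<bar>r\<bar>) * (- 1 + sqrt (1 + 4 / c * max (\<bar>r\<bar> - \<beta> / c) 0)))"

text \<open>
  The tangent inequality of the convex function \<open>\<bar>\<cdot>\<bar>^3 / 3\<close>. For \<open>a, b \<ge> 0\<close> the gap factors as
  \<open>(a - b)\<^sup>2 * (a + 2 * b) / 3\<close>, and \<open>y * x \<le> \<bar>y\<bar> * \<bar>x\<bar>\<close> reduces the general case to this one.
\<close>

lemma abs_cube_tangent:
  fixes x y :: real
  shows "\<bar>y\<bar> ^ 3 / 3 + y * \<bar>y\<bar> * (x - y) \<le> \<bar>x\<bar> ^ 3 / 3"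
proof -
  have "a ^ 3 / 3 - b ^ 3 / 3 - b\<^sup>2 * (a - b) = (a - b)\<^sup>2 * (a + 2 * b) / 3" for a b :: real
    by (simp add: power2_eq_square power3_eq_cube field_simps)
  note this[of "\<bar>x\<bar>" "\<bar>y\<bar>"]
  moreover have "0 \<le> (\<bar>x\<bar> - \<bar>y\<bar>)\<^sup>2 * (\<bar>x\<bar> + 2 * \<bar>y\<bar>) / 3"
    by simp
  moreover have "y * \<bar>y\<bar> * (x - y) \<le> \<bar>y\<bar>\<^sup>2 * (\<bar>x\<bar> - \<bar>y\<bar>)"
  proof -
    have "\<bar>y\<bar> * (y * x) \<le> \<bar>y\<bar> * (\<bar>y\<bar> * \<bar>x\<bar>)"
      by (intro mult_left_mono) (simp_all flip: abs_mult)
    moreover have "\<bar>y\<bar> * (y * y) = \<bar>y\<bar> * (\<bar>y\<bar> * \<bar>y\<bar>)"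
      by simp
    ultimately show ?thesis
      by (simp add: power2_eq_square algebra_simps)
  qed
  ultimately show ?thesis
    by linarith
qed

text \<open>
  The hypotheses \<open>\<bar>w\<bar> \<le> \<beta>\<close> and \<open>w * y = \<beta> * \<bar>y\<bar>\<close> say that \<open>w\<close> is a subgradient of \<open>\<beta> * \<bar>\<cdot>\<bar>\<close> at \<open>y\<close>.
\<close>

lemma stationary_quadratic_growth:
  assumes "\<bar>w\<bar> \<le> \<beta>" "w * y = \<beta> * \<bar>y\<bar>" and stationary: "w + y * \<bar>y\<bar> + c * (y - r) = 0"
  shows "scalar_objective \<beta> c r y + c / 2 * (x - y)\<^sup>2 \<le> scalar_objective \<beta> c r x"
proof -
  have "w * x \<le> \<bar>w\<bar> * \<bar>x\<bar>"
    by (simp flip: abs_mult)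
  also have "\<dots> \<le> \<beta> * \<bar>x\<bar>"
    using assms(1) by (simp add: mult_right_mono)
  finally have "\<beta> * \<bar>y\<bar> + w * (x - y) \<le> \<beta> * \<bar>x\<bar>"
    using assms(2) by (simp add: right_diff_distrib)
  moreover have "\<bar>y\<bar> ^ 3 / 3 + y * \<bar>y\<bar> * (x - y) \<le> \<bar>x\<bar> ^ 3 / 3"
    by (rule abs_cube_tangent)
  moreover have "c / 2 * (x - r)\<^sup>2 = c / 2 * (y - r)\<^sup>2 + c * (y - r) * (x - y) + c / 2 * (x - y)\<^sup>2"
    by (simp add: power2_eq_square field_simps)
  moreover have "w * (x - y) + y * \<bar>y\<bar> * (x - y) + c * (y - r) * (x - y) = 0"
    unfolding distrib_right[symmetric] stationary by simp
  ultimately show ?thesis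
    unfolding scalar_objective_def by linarith
qed

lemma quadratic_root:
  fixes c m :: real
  assumes "c > 0" "m \<ge> 0"
  defines "t \<equiv> c / 2 * (- 1 + sqrt (1 + 4 / c * m))"
  shows "t \<ge> 0" and "t\<^sup>2 + c * t = c * m"
proof -
  define q where "q = sqrt (1 + 4 / c * m)"
  have q2: "q\<^sup>2 = 1 + 4 / c * m"
    unfolding q_def using assms by simp
  have "q \<ge> 1"
    unfolding q_def using assms by simp
  then show "t \<ge> 0"
    unfolding t_def q_def[symmetric] using assms by simp
  have "t\<^sup>2 + c * t = c\<^sup>2 / 4 * (q\<^sup>2 - 1)"
    unfolding t_def q_def[symmetric] by (simp add: power2_eq_square field_simps)
  then show "t\<^sup>2 + c * t = c * m"
    using assms q2 by (simp add: power2_eq_square)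
qed

lemma shrink_stationary:
  fixes c \<beta> r :: real
  assumes "c > 0" "\<beta> > 0"
  defines "y \<equiv> shrink \<beta> c r"
  obtains w where "\<bar>w\<bar> \<le> \<beta>" "w * y = \<beta> * \<bar>y\<bar>" "w + y * \<bar>y\<bar> + c * (y - r) = 0"
proof (cases "c * \<bar>r\<bar> \<le> \<beta>")
  case True
  then have "\<bar>r\<bar> - \<beta> / c \<le> 0"
    using assms by (simp add: field_simps)
  then have "y = 0"
    unfolding y_def shrink_def by (simp add: max_def)
  moreover have "\<bar>c * r\<bar> \<le> \<beta>"
    using True assms by (simp add: abs_mult)
  ultimately show ?thesis
    by (intro that[of "c * r"]) simp_all
next
  case False
  define t where "t = c / 2 * (- 1 + sqrt (1 + 4 / c * (\<bar>r\<bar> - \<beta> / c)))"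
  have "r \<noteq> 0"
    using False assms by auto
  have m: "\<bar>r\<bar> - \<beta> / c \<ge> 0"
    using False assms by (simp add: field_simps)
  have t: "t \<ge> 0" "t\<^sup>2 + c * t = c * \<bar>r\<bar> - \<beta>"
    using quadratic_root[OF assms(1) m] assms(1)
    unfolding t_def by (simp_all add: right_diff_distrib)
  have y: "y = sgn r * t"
    using \<open>r \<noteq> 0\<close> m unfolding y_def shrink_def t_def by (simp add: sgn_if max_def)
  have abs_y: "\<bar>y\<bar> = t"
    using y t(1) \<open>r \<noteq> 0\<close> by (simp add: abs_mult abs_sgn_eq)
  show ?thesis
  proof (rule that[of "sgn r * \<beta>"])
    show "\<bar>sgn r * \<beta>\<bar> \<le> \<beta>"
      using assms by (simp add: abs_mult abs_sgn_eq)
    show "sgn r * \<beta> * y = \<beta> * \<bar>y\<bar>"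
      using \<open>r \<noteq> 0\<close> unfolding abs_y by (simp add: y sgn_if)
    have "sgn r * \<beta> + y * \<bar>y\<bar> + c * (y - r) = sgn r * (\<beta> + t\<^sup>2 + c * t - c * \<bar>r\<bar>)"
      unfolding abs_y using \<open>r \<noteq> 0\<close>
      by (cases "r > 0") (simp_all add: y power2_eq_square algebra_simps)
    then show "sgn r * \<beta> + y * \<bar>y\<bar> + c * (y - r) = 0"
      using t(2) by simp
  qed
qed

lemma d_objective_eq_sum:
  assumes "\<alpha> \<in> carrier_vec N" "d \<in> carrier_vec N"
    and \<rho>: "\<And>n. n < N \<Longrightarrow> \<rho> n = (diff_mat N * recon_mat N *\<^sub>v u + \<alpha>) $ n"
  shows "d_objective N h \<mu> \<beta> 3 u \<alpha> d = (\<Sum>n<N. scalar_objective \<beta> (\<mu> * h) (\<rho> n) (d $ n))"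
proof -
  define v where "v = diff_mat N * recon_mat N *\<^sub>v u"
  have v: "v \<in> carrier_vec N"
    unfolding v_def by (rule carrier_vecI) (simp add: diff_mat_def)
  have \<rho>_eq: "\<rho> n = v $ n + \<alpha> $ n" if "n < N" for n
    using \<rho>[OF that] assms(1) that unfolding v_def[symmetric] by simp
  have "norm_1 d = (\<Sum>n<N. \<bar>d $ n\<bar>)"
    using assms(2) by (simp add: norm_1_def)
  moreover have "norm_p_pow_p 3 d = (\<Sum>n<N. \<bar>d $ n\<bar> ^ 3)"
    using assms(2) by (simp add: norm_p_pow_p_def)
  moreover have "(norm_2 (d - v - \<alpha>))\<^sup>2 = (\<Sum>n<N. (d $ n - \<rho> n)\<^sup>2)"
  proof -
    have "(norm_2 (d - v - \<alpha>))\<^sup>2 = (\<Sum>n<N. ((d - v - \<alpha>) $ n)\<^sup>2)"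
      using assms(1) by (simp add: norm_2_def sum_nonneg)
    also have "\<dots> = (\<Sum>n<N. (d $ n - \<rho> n)\<^sup>2)"
      using assms(1,2) v by (intro sum.cong) (auto simp: \<rho>_eq diff_diff_eq)
    finally show ?thesis .
  qed
  ultimately show ?thesis
    unfolding d_objective_def scalar_objective_def v_def[symmetric]
    by (simp only: sum.distrib sum_distrib_left mult_1_left times_divide_eq_left)
qed

theorem mainTheorem2:
  fixes N :: nat and h \<mu> \<beta> p :: real and u \<alpha> :: "real vec" and \<rho> :: "nat \<Rightarrow> real"
  assumes "N \<ge> 1" and "h = 1 / real N" and "\<mu> > 0" and "\<beta> > 0" and "p = 3"
    and "u \<in> carrier_vec (N - 1)" and "\<alpha> \<in> carrier_vec N"
    and "\<And>n. n < N \<Longrightarrow> \<rho> n = (diff_mat N * recon_mat N *\<^sub>v u + \<alpha>) $ n"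
  shows "(\<exists>!d. is_arg_min (d_objective N h \<mu> \<beta> p u \<alpha>) (\<lambda>d. d \<in> carrier_vec N) d) \<and>
    (\<forall>d. is_arg_min (d_objective N h \<mu> \<beta> p u \<alpha>) (\<lambda>d. d \<in> carrier_vec N) d \<longrightarrow>
      (\<forall>n<N. d $ n =
        (if \<rho> n = 0 then 0
         else \<mu> * h * \<rho> n / (2 * \<bar>\<rho> n\<bar>) *
           (- 1 + sqrt (1 + 4 / (\<mu> * h) * max (\<bar>\<rho> n\<bar> - \<beta> / (\<mu> * h)) 0)))))"
proof -
  define c where "c = \<mu> * h"
  have "c > 0"
    unfolding c_def using assms(1-3) by simp
  define F where "F = d_objective N h \<mu> \<beta> p u \<alpha>"
  define e where "e = vec N (\<lambda>n. shrink \<beta> c (\<rho> n))"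
  have e: "e \<in> carrier_vec N"
    unfolding e_def by simp
  have F_eq: "F d = (\<Sum>n<N. scalar_objective \<beta> c (\<rho> n) (d $ n))" if "d \<in> carrier_vec N" for d
    unfolding F_def c_def assms(5) using assms(7) that assms(8) by (rule d_objective_eq_sum)
  have scalar: "scalar_objective \<beta> c r (shrink \<beta> c r) + c / 2 * (x - shrink \<beta> c r)\<^sup>2
      \<le> scalar_objective \<beta> c r x" for r x
    using \<open>c > 0\<close> \<open>\<beta> > 0\<close>
    by (rule shrink_stationary) (rule stationary_quadratic_growth)
  have growth: "F e + c / 2 * (\<Sum>n<N. (d $ n - e $ n)\<^sup>2) \<le> F d" if "d \<in> carrier_vec N" for d
  proof -
    have "F e + c / 2 * (\<Sum>n<N. (d $ n - e $ n)\<^sup>2) =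
        (\<Sum>n<N. scalar_objective \<beta> c (\<rho> n) (e $ n) + c / 2 * (d $ n - e $ n)\<^sup>2)"
      by (simp add: F_eq[OF e] sum.distrib sum_distrib_left)
    also have "\<dots> \<le> (\<Sum>n<N. scalar_objective \<beta> c (\<rho> n) (d $ n))"
      by (intro sum_mono) (use scalar in \<open>simp add: e_def\<close>)
    finally show ?thesis
      by (simp add: F_eq[OF that])
  qed
  have min: "is_arg_min F (\<lambda>d. d \<in> carrier_vec N) e"
    unfolding is_arg_min_linorder
  proof (intro conjI allI impI e)
    fix d :: "real vec"
    assume "d \<in> carrier_vec N"
    moreover have "0 \<le> c / 2 * (\<Sum>n<N. (d $ n - e $ n)\<^sup>2)"
      using \<open>c > 0\<close> by (simp add: sum_nonneg)
    ultimately show "F e \<le> F d"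
      using growth[of d] by linarith
  qed
  have unique: "d = e" if "is_arg_min F (\<lambda>d. d \<in> carrier_vec N) d" for d
  proof -
    have d: "d \<in> carrier_vec N" and "F d \<le> F e"
      using that e by (auto simp: is_arg_min_linorder)
    then have "c / 2 * (\<Sum>n<N. (d $ n - e $ n)\<^sup>2) \<le> 0"
      using growth[OF d] by linarith
    then have "(\<Sum>n<N. (d $ n - e $ n)\<^sup>2) \<le> 0"
      using \<open>c > 0\<close> by (simp add: mult_le_0_iff)
    moreover have "(\<Sum>n<N. (d $ n - e $ n)\<^sup>2) \<ge> 0"
      by (simp add: sum_nonneg)
    ultimately have "(\<Sum>n<N. (d $ n - e $ n)\<^sup>2) = 0"
      by linarith
    then have "\<forall>n<N. d $ n = e $ n"
      by (simp add: sum_nonneg_eq_0_iff)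
    then show "d = e"
      using d e by (intro eq_vecI) auto
  qed
  have "\<forall>n<N. e $ n =
      (if \<rho> n = 0 then 0
       else \<mu> * h * \<rho> n / (2 * \<bar>\<rho> n\<bar>) *
         (- 1 + sqrt (1 + 4 / (\<mu> * h) * max (\<bar>\<rho> n\<bar> - \<beta> / (\<mu> * h)) 0)))"
    by (simp add: e_def shrink_def c_def)
  then show ?thesis
    using min unique unfolding F_def by blast
qed

end
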